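(* Let $\mathbf{A} = \mathbf{L}+\mathbf{D}+\mathbf{L}^\mathsf{T}\in\mathbb{R}^{n\times n}$ be symmetric, where $\mathbf{L}$ is strictly lower triangular and $\mathbf{D}$ is diagonal, and assume that $\mathbf{D}$ is symmetric positive definite. Let $\omega\in\mathbb{R}$. Then the SSOR splitting matrix $$\mathbf{M} = \omega^{-1}(2-\omega)^{-1}(\mathbf{D}+\omega\mathbf{L})\mathbf{D}^{-1}(\mathbf{D}+\omega\mathbf{L}^\mathsf{T})$$ of $\mathbf{A}$ is nonsingular if and only if $\omega\neq 0,2$. For $\ell$ odd, the SSOR inner-iteration preconditioning matrix $\mathbf{C}^{(\ell)}$ is symmetric positive definite if and only if $\omega\in(0,2)$. Let $$\mu = \lambda_{\min}\bigl(2\mathbf{D}^{-\frac12}\mathbf{L}\mathbf{D}^{-1}\mathbf{L}^\mathsf{T}\mathbf{D}^{-\frac12}+\mathbf{D}^{-\frac12}(\mathbf{L}+\mathbf{L}^\mathsf{T})\mathbf{D}^{-\frac12}\bigr)+1.$$ Then, for $\ell$ even, the SSOR inner-iteration preconditioning matrix $\mathbf{C}^{(\ell)}$ is symmetric positive definite if $\omega$ satisfies the following: - when $\mu<0$: $\omega<\frac{1+\sqrt{1-2\mu}}{\mu}$, or $0<\omega<\frac{1-\sqrt{1-2\mu}}{\mu}$, or $2<\omega$; - when $0<\mu<\frac12$: $0<\omega<\frac{1-\sqrt{1-2\mu}}{\mu}$, or $2<\omega<\frac{1+\sqrt{1-2\mu}}{\mu}$; - when $\frac12<\mu$: $0<\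omega<2$.
   Context: $\lambda_{\min}(\cdot)$ denotes the smallest eigenvalue of a symmetric matrix. For $\omega\neq0,2$ and an integer $\ell\ge1$, the SSOR inner-iteration preconditioning matrix is $\mathbf{C}^{(\ell)}=\sum_{i=0}^{\ell-1}\mathbf{H}^i\mathbf{M}^{-1}$ with $\mathbf{N}=\mathbf{M}-\mathbf{A}$ and $\mathbf{H}=\mathbf{M}^{-1}\mathbf{N}$. For $\omega\in\{0,2\}$ the expression for $\mathbf{M}$ is undefined, and "nonsingular" in the first assertion is understood as "well defined and nonsingular"; likewise $\mathbf{C}^{(\ell)}$ is then undefined and not counted as positive definite. *)

theory Defs
  imports "HOL-Analysis.Analysis"
begin

text \<open>
  The index type ranges over the finite linear orders, so that \<open>n = CARD('n)\<close> is an arbitrary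
  positive integer and ``strictly lower triangular'' makes sense.
\<close>

definition diagonal_mat :: "real^'n^'n \<Rightarrow> bool" where
  "diagonal_mat D \<longleftrightarrow> (\<forall>i j. i \<noteq> j \<longrightarrow> D $ i $ j = 0)"

definition strictly_lower_triangular :: "real^('n::{finite,linorder})^('n::{finite,linorder}) \<Rightarrow> bool" where
  "strictly_lower_triangular L \<longleftrightarrow> (\<forall>i j. i \<le> j \<longrightarrow> L $ i $ j = 0)"

definition symmetric_mat :: "real^'n^'n \<Rightarrow> bool" where
  "symmetric_mat A \<longleftrightarrow> transpose A = A"

definition sym_pos_def :: "real^'n^'n \<Rightarrow> bool" where
  "sym_pos_def A \<longleftrightarrow> symmetric_mat A \<and> (\<forall>x. x \<noteq> 0 \<longrightarrow> x \<bullet> (A *v x) > 0)"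

text \<open>The class operations \<open>*\<close> and \<open>^\<close> on vectors are componentwise, hence the explicit power.\<close>

primrec mat_power :: "real^'n^'n \<Rightarrow> nat \<Rightarrow> real^'n^'n" where
  "mat_power A 0 = mat 1"
| "mat_power A (Suc k) = A ** mat_power A k"

definition is_eigenvalue :: "real^'n^'n \<Rightarrow> real \<Rightarrow> bool" where
  "is_eigenvalue A c \<longleftrightarrow> (\<exists>v. v \<noteq> 0 \<and> A *v v = c *\<^sub>R v)"

text \<open>Only meaningful when a least real eigenvalue exists, as for symmetric matrices.\<close>

definition lambda_min :: "real^'n^'n \<Rightarrow> real" where
  "lambda_min A = (LEAST c. is_eigenvalue A c)"

text \<open>\<open>D\<^bsup>-1/2\<^esup>\<close> for a diagonal matrix with positive diagonal entries; see the lemmas below.\<close>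

definition diag_inv_sqrt :: "real^'n^'n \<Rightarrow> real^'n^'n" where
  "diag_inv_sqrt D = (\<chi> i j. if i = j then 1 / sqrt (D $ i $ i) else 0)"

lemma sym_pos_def_diag_pos:
  fixes D :: "real^'n^'n"
  assumes "sym_pos_def D"
  shows "D $ i $ i > 0"
proof -
  have "axis i (1::real) \<bullet> (D *v axis i 1) > 0"
    using assms by (simp add: sym_pos_def_def axis_eq_0_iff)
  then show ?thesis
    by (simp add: inner_axis' matrix_vector_mul_component inner_axis)
qed

lemma sym_pos_def_diag_inv_sqrt:
  fixes D :: "real^'n^'n"
  assumes "sym_pos_def D"
  shows "sym_pos_def (diag_inv_sqrt D)"
proof -
  have mv: "diag_inv_sqrt D *v x = (\<chi> i. x $ i / sqrt (D $ i $ i))" for x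
    by (simp add: vec_eq_iff diag_inv_sqrt_def matrix_vector_mult_def if_distrib [of "\<lambda>c. c * _"]
        cong: if_cong)
  have "x \<bullet> (diag_inv_sqrt D *v x) > 0" if nz: "x \<noteq> 0" for x
  proof -
    obtain k where k: "x $ k \<noteq> 0" using nz vec_eq_iff [of x 0] by auto
    have "(\<Sum>i\<in>UNIV. x $ i * (x $ i / sqrt (D $ i $ i))) > 0"
    proof (rule sum_pos2 [of _ k])
      have "x $ k * x $ k > 0" using k by (metis not_real_square_gt_zero)
      then show "0 < x $ k * (x $ k / sqrt (D $ k $ k))"
        using sym_pos_def_diag_pos [OF assms, of k] by simp
      show "0 \<le> x $ i * (x $ i / sqrt (D $ i $ i))" for i
        using sym_pos_def_diag_pos [OF assms, of i] by simp
    qed auto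
    then show ?thesis by (simp add: mv inner_vec_def)
  qed
  moreover have "transpose (diag_inv_sqrt D) = diag_inv_sqrt D"
    by (auto simp: transpose_def diag_inv_sqrt_def vec_eq_iff)
  ultimately show ?thesis by (simp add: sym_pos_def_def symmetric_mat_def)
qed

lemma diag_inv_sqrt_square:
  fixes D :: "real^'n^'n"
  assumes "diagonal_mat D" "sym_pos_def D"
  shows "diag_inv_sqrt D ** diag_inv_sqrt D = matrix_inv D"
proof -
  let ?E = "(\<chi> i j. if i = j then 1 / D $ i $ i else 0) :: real^'n^'n"
  have pos: "D $ i $ i > 0" for i using assms(2) by (rule sym_pos_def_diag_pos)
  have ne: "D $ i $ i \<noteq> 0" for i using pos [of i] by simp
  have DE: "D ** ?E = mat 1"
    using assms(1) ne
    by (auto simp: vec_eq_iff matrix_matrix_mult_def mat_def diagonal_mat_def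
        if_distrib [of "\<lambda>c. _ * c"] cong: if_cong)
  then have ED: "?E ** D = mat 1"
    by (simp only: matrix_left_right_inverse)
  have "D ** matrix_inv D = mat 1 \<and> matrix_inv D ** D = mat 1"
    unfolding matrix_inv_def by (rule someI [of _ ?E]) (simp only: DE ED)
  then have "?E ** (D ** matrix_inv D) = ?E" by simp
  then have "matrix_inv D = ?E" unfolding matrix_mul_assoc ED by simp
  moreover have "sqrt (D $ i $ i) * sqrt (D $ i $ i) = D $ i $ i" for i
    using pos [of i] by (simp add: less_imp_le)
  then have "diag_inv_sqrt D ** diag_inv_sqrt D = ?E"
    by (auto simp: vec_eq_iff matrix_matrix_mult_def diag_inv_sqrt_def
        if_distrib [of "\<lambda>c. _ * c"] cong: if_cong)
  ultimately show ?thesis by simp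
qed

text \<open>
  Division is total in HOL, so \<open>ssor_M\<close> and the preconditioner below have (irrelevant) values even where the
  factor \<open>\<omega>\<^bsup>-1\<^esup>(2-\<omega>)\<^bsup>-1\<^esup>\<close> does not exist.  Assertions about them are therefore always
  conjoined with \<open>ssor_defined \<omega>\<close>.
\<close>

definition ssor_defined :: "real \<Rightarrow> bool" where
  "ssor_defined \<omega> \<longleftrightarrow> \<omega> * (2 - \<omega>) \<noteq> 0"

definition ssor_M :: "real^'n^'n \<Rightarrow> real^'n^'n \<Rightarrow> real \<Rightarrow> real^'n^'n" where
  "ssor_M L D \<omega> = (inverse \<omega> * inverse (2 - \<omega>)) *\<^sub>R
     ((D + \<omega> *\<^sub>R L) ** matrix_inv D ** (D + \<omega> *\<^sub>R transpose L))"

text \<open>\<open>\<Sum>\<^sub>i H\<^sup>i M\<^bsup>-1\<^esup>\<close> over \<open>0 \<le> i < l\<close>, where \<open>N = M - A\<close> and \<open>H = M\<^bsup>-1\<^esup> N\<close>.\<close>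

definition inner_iteration_prec :: "real^'n^'n \<Rightarrow> real^'n^'n \<Rightarrow> nat \<Rightarrow> real^'n^'n" where
  "inner_iteration_prec M A l =
     (let N = M - A; H = matrix_inv M ** N
      in \<Sum>i<l. mat_power H i ** matrix_inv M)"

definition ssor_mu :: "real^'n^'n \<Rightarrow> real^'n^'n \<Rightarrow> real" where
  "ssor_mu L D =
     (let S = diag_inv_sqrt D
      in lambda_min (2 *\<^sub>R (S ** L ** matrix_inv D ** transpose L ** S)
                     + S ** (L + transpose L) ** S) + 1)"

end

theory Submission
  imports Defs
begin

text \<open>
  With \<open>c = 1 / (\<omega> (2 - \<omega>))\<close> both parts of the splitting are congruent to
  \<open>D\<^bsup>-1\<^esup>\<close> up to the common factor \<open>c\<close>: \<open>M = c P\<close> and \<open>N = c Q\<close>, where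
  \<open>P = (D + \<omega> L) D\<^bsup>-1\<^esup> (D + \<omega> L)\<^sup>T\<close> is positive definite and
  \<open>Q = ((1 - \<omega>) D - \<omega> L) D\<^bsup>-1\<^esup> ((1 - \<omega>) D - \<omega> L)\<^sup>T\<close> is positive semidefinite.  Hence
  \<open>C = c\<^bsup>-1\<^esup> \<Sum>\<^sub>i (P\<^bsup>-1\<^esup> Q)\<^sup>i P\<^bsup>-1\<^esup>\<close>, where the sum is positive definite for every positive
  number of terms, and so \<open>C\<close> is positive definite exactly if \<open>c > 0\<close>, whatever the parity.
  The ranges of \<open>\<omega>\<close> outside \<open>(0, 2)\<close> never occur in the even case, because always
  \<open>\<mu> > 1 / 2\<close>: with \<open>S = D\<^bsup>-1/2\<^esup>\<close> and \<open>E = D / 2 + L\<close> the matrix defining \<open>\<mu>\<close> equals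
  \<open>2 S E D\<^bsup>-1\<^esup> E\<^sup>T S - 1 / 2\<close>, and \<open>E\<close> is nonsingular.
\<close>

section \<open>Matrix algebra, inverses and triangular matrices\<close>

lemma matrix_add_rdistrib:
  fixes A B :: "real^'n^'m" and C :: "real^'k^'n"
  shows "(A + B) ** C = A ** C + B ** C"
  by (simp add: vec_eq_iff matrix_matrix_mult_def sum.distrib algebra_simps)

lemma matrix_scaleR_left:
  fixes A :: "real^'n^'m" and B :: "real^'k^'n"
  shows "(c *\<^sub>R A) ** B = c *\<^sub>R (A ** B)"
  by (rule scalar_matrix_assoc[symmetric])

lemma matrix_scaleR_right:
  fixes A :: "real^'n^'m" and B :: "real^'k^'n"
  shows "A ** (c *\<^sub>R B) = c *\<^sub>R (A ** B)"
  by (simp add: matrix_scalar_ac scalar_matrix_assoc)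

lemma transpose_plus:
  fixes A B :: "real^'n^'m"
  shows "transpose (A + B) = transpose A + transpose B"
  by (simp add: vec_eq_iff transpose_def)

lemma inner_transpose_mult:
  fixes A :: "real^'n^'m"
  shows "x \<bullet> (A *v y) = (transpose A *v x) \<bullet> y"
  by (simp add: dot_lmul_matrix)

lemma matrix_inv_mult:
  fixes A :: "real^'n^'n"
  assumes "invertible A"
  shows "A ** matrix_inv A = mat 1" "matrix_inv A ** A = mat 1"
proof -
  have "A ** matrix_inv A = mat 1 \<and> matrix_inv A ** A = mat 1"
    using assms unfolding matrix_inv_def invertible_def by (rule someI_ex)
  then show "A ** matrix_inv A = mat 1" "matrix_inv A ** A = mat 1" by auto
qed

lemma matrix_inv_unique_right:
  fixes A B :: "real^'n^'n"
  assumes "A ** B = mat 1"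
  shows "matrix_inv A = B"
proof -
  have "invertible A"
    using assms matrix_left_right_inverse unfolding invertible_def by blast
  then have "matrix_inv A ** (A ** B) = B"
    by (simp add: matrix_mul_assoc matrix_inv_mult)
  then show ?thesis using assms by simp
qed

lemma matrix_inv_scaleR:
  fixes A :: "real^'n^'n"
  assumes "invertible A" "c \<noteq> 0"
  shows "matrix_inv (c *\<^sub>R A) = inverse c *\<^sub>R matrix_inv A"
  by (rule matrix_inv_unique_right)
    (simp add: assms matrix_scaleR_left matrix_scaleR_right matrix_inv_mult)

lemma invertible_iff_mult_zero:
  fixes A :: "real^'n^'n"
  shows "invertible A \<longleftrightarrow> (\<forall>x. A *v x = 0 \<longrightarrow> x = 0)"
  unfolding invertible_left_inverse matrix_left_invertible_ker ..

text \<open>Let \<open>k\<close> be the first nonzero coordinate of a kernel vector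
  \<open>x\<close>. In row \<open>k\<close> the columns after \<open>k\<close> vanish by
  triangularity and the coordinates before \<open>k\<close> vanish by choice of \<open>k\<close>, so
  only \<open>a * D $ k $ k * x $ k\<close> remains, which is nonzero.\<close>

lemma invertible_diagonal_plus_strictly_lower:
  fixes D L :: "real^('n::{finite,linorder})^('n::{finite,linorder})"
  assumes "diagonal_mat D" "\<And>i. D $ i $ i \<noteq> 0" "strictly_lower_triangular L" "a \<noteq> 0"
  shows "invertible (a *\<^sub>R D + b *\<^sub>R L)"
  unfolding invertible_iff_mult_zero
proof (intro allI impI, rule ccontr)
  let ?E = "a *\<^sub>R D + b *\<^sub>R L"
  fix x assume x: "?E *v x = 0" "x \<noteq> 0"
  define k where "k = Min {k. x $ k \<noteq> 0}"
  have "{k. x $ k \<noteq> 0} \<noteq> {}" using x(2) by (auto simp: vec_eq_iff)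
  then have "k \<in> {k. x $ k \<noteq> 0}"
    unfolding k_def by (intro Min_in) auto
  then have k: "x $ k \<noteq> 0" by simp
  have less: "x $ j = 0" if "j < k" for j
    using that Min_le[of "{k. x $ k \<noteq> 0}" j] unfolding k_def by (meson finite mem_Collect_eq not_le)
  have "(?E *v x) $ k = (\<Sum>j\<in>UNIV. if j = k then a * D $ k $ k * x $ k else 0)"
    unfolding matrix_vector_mult_def vec_lambda_beta
  proof (rule sum.cong)
    fix j
    show "?E $ k $ j * x $ j = (if j = k then a * D $ k $ k * x $ k else 0)"
      using assms less[of j] by (cases j k rule: linorder_cases)
        (auto simp: diagonal_mat_def strictly_lower_triangular_def)
  qed simp
  then show False using x(1) k assms(2,4) by simp
qed

section \<open>Positive definite and semidefinite matrices under congruence\<close>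

definition sym_pos_semidef :: "real^'n^'n \<Rightarrow> bool" where
  "sym_pos_semidef A \<longleftrightarrow> symmetric_mat A \<and> (\<forall>x. x \<bullet> (A *v x) \<ge> 0)"

lemma sym_pos_def_imp_semidef: "sym_pos_def A \<Longrightarrow> sym_pos_semidef A"
  unfolding sym_pos_def_def sym_pos_semidef_def
  by (metis inner_zero_left order_less_imp_le order_refl)

lemma sym_pos_semidef_congruence:
  fixes A B :: "real^'n^'n"
  assumes "sym_pos_semidef A"
  shows "sym_pos_semidef (B ** A ** transpose B)"
proof -
  have "x \<bullet> ((B ** A ** transpose B) *v x) = (transpose B *v x) \<bullet> (A *v (transpose B *v x))" for x
    by (simp only: matrix_vector_mul_assoc[symmetric] inner_transpose_mult[of x B])
  then show ?thesis
    using assms by (simp add: sym_pos_semidef_def symmetric_mat_def matrix_transpose_mul matrix_mul_assoc)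
qed

lemma sym_pos_def_congruence:
  fixes A B :: "real^'n^'n"
  assumes "sym_pos_def A" "invertible B"
  shows "sym_pos_def (B ** A ** transpose B)"
proof -
  have "x \<bullet> ((B ** A ** transpose B) *v x) = (transpose B *v x) \<bullet> (A *v (transpose B *v x))" for x
    by (simp only: matrix_vector_mul_assoc[symmetric] inner_transpose_mult[of x B])
  moreover have "transpose B *v x \<noteq> 0" if "x \<noteq> 0" for x
    using that transpose_invertible[OF assms(2)] invertible_iff_mult_zero by blast
  ultimately show ?thesis
    using assms by (simp add: sym_pos_def_def symmetric_mat_def matrix_transpose_mul matrix_mul_assoc)
qed

lemma sym_pos_def_add_semidef:
  assumes "sym_pos_def A" "sym_pos_semidef B"
  shows "sym_pos_def (A + B)"
  using assms
  by (auto simp: sym_pos_def_def sym_pos_semidef_def symmetric_mat_def transpose_plus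
      matrix_vector_mult_add_rdistrib inner_add_right intro: add_pos_nonneg)

lemma sym_pos_def_invertible:
  assumes "sym_pos_def A"
  shows "invertible A"
  using assms unfolding invertible_iff_mult_zero sym_pos_def_def
  by (metis inner_zero_right less_irrefl)

text \<open>Once the inverse is known to be symmetric, it equals its own congruence transform
  \<open>matrix_inv A ** A ** transpose (matrix_inv A)\<close> of \<open>A\<close>.\<close>

lemma sym_pos_def_matrix_inv:
  assumes "sym_pos_def A"
  shows "sym_pos_def (matrix_inv A)"
proof -
  note inv = matrix_inv_mult[OF sym_pos_def_invertible[OF assms]]
  have A: "transpose A = A" using assms by (simp add: sym_pos_def_def symmetric_mat_def)
  have "transpose (matrix_inv A ** A) = mat 1" by (simp add: inv)
  then have "A ** transpose (matrix_inv A) = mat 1" by (simp add: matrix_transpose_mul A)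
  then have sym: "transpose (matrix_inv A) = matrix_inv A"
    by (rule matrix_inv_unique_right[symmetric])
  have "invertible (matrix_inv A)" using inv unfolding invertible_def by blast
  then have "sym_pos_def (matrix_inv A ** A ** transpose (matrix_inv A))"
    by (rule sym_pos_def_congruence[OF assms])
  then show ?thesis by (simp add: sym inv)
qed

lemma sym_pos_def_scaleR_iff:
  fixes A :: "real^'n^'n"
  assumes "sym_pos_def A"
  shows "sym_pos_def (c *\<^sub>R A) \<longleftrightarrow> c > 0"
proof
  \<comment> \<open>The sign of \<open>c\<close> can only be read off from a nonzero test vector;
    any unit coordinate vector will do.\<close>
  have "axis undefined 1 \<noteq> (0 :: real^'n)" by (simp add: axis_eq_0_iff)
  then obtain x :: "real^'n" where "x \<noteq> 0" by blast
  then have "x \<bullet> (A *v x) > 0" using assms by (simp add: sym_pos_def_def)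
  moreover assume "sym_pos_def (c *\<^sub>R A)"
  then have "x \<bullet> ((c *\<^sub>R A) *v x) > 0" using \<open>x \<noteq> 0\<close> by (simp add: sym_pos_def_def)
  ultimately show "c > 0"
    by (simp add: scaleR_matrix_vector_assoc[symmetric] zero_less_mult_iff)
next
  assume "c > 0"
  then show "sym_pos_def (c *\<^sub>R A)" using assms
    by (simp add: sym_pos_def_def symmetric_mat_def transpose_scalar scaleR_matrix_vector_assoc[symmetric])
qed

section \<open>Positivity of the inner-iteration sum\<close>

lemma mat_power_commute: "mat_power A k ** A = A ** mat_power A k"
  by (induction k) (simp_all add: matrix_mul_assoc[symmetric])

text \<open>Since \<open>W ** Q\<close> has transpose \<open>Q ** W\<close>, congruence by
  \<open>W ** Q\<close> raises the power by two. The induction therefore goes in steps of two,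
  starting from \<open>W\<close> and from \<open>W ** Q ** W\<close>, the latter a congruence
  transform of \<open>Q\<close>.\<close>

lemma mat_power_mult_semidef:
  fixes W Q :: "real^'n^'n"
  assumes W: "sym_pos_semidef W" and Q: "sym_pos_semidef Q"
  shows "sym_pos_semidef (mat_power (W ** Q) k ** W)"
proof (induction k rule: induct_nat_012)
  case 0
  then show ?case using W by simp
next
  case 1
  have "transpose W = W" using W by (simp add: sym_pos_semidef_def symmetric_mat_def)
  then show ?case using sym_pos_semidef_congruence[OF Q, of W] by simp
next
  case (ge2 k)
  have "transpose W = W" "transpose Q = Q"
    using W Q by (simp_all add: sym_pos_semidef_def symmetric_mat_def)
  then have tr: "transpose (W ** Q) = Q ** W" by (simp add: matrix_transpose_mul)
  have "mat_power (W ** Q) (Suc (Suc k)) ** W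
      = (W ** Q) ** (mat_power (W ** Q) k ** (W ** Q)) ** W"
    by (simp add: mat_power_commute)
  also have "\<dots> = (W ** Q) ** (mat_power (W ** Q) k ** W) ** transpose (W ** Q)"
    by (simp add: tr matrix_mul_assoc)
  finally show ?case using sym_pos_semidef_congruence[OF ge2(1)] by simp
qed

text \<open>The term with \<open>i = 0\<close> is \<open>W\<close> itself and supplies definiteness;
  every later term is semidefinite.\<close>

lemma sym_pos_def_inner_sum:
  fixes W Q :: "real^'n^'n"
  assumes W: "sym_pos_def W" and Q: "sym_pos_semidef Q" and "l \<ge> 1"
  shows "sym_pos_def (\<Sum>i<l. mat_power (W ** Q) i ** W)"
  using \<open>l \<ge> 1\<close>
proof (induction l rule: dec_induct)
  case base
  then show ?case using W by simp
next
  case (step l)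
  then show ?case
    using mat_power_mult_semidef[OF sym_pos_def_imp_semidef[OF W] Q]
    by (simp add: sym_pos_def_add_semidef)
qed

text \<open>The factor \<open>c\<close> cancels in the iteration matrix, which is
  \<open>matrix_inv P ** Q\<close>, and survives only as \<open>inverse c\<close> in front of a
  positive definite sum.\<close>

lemma inner_iteration_prec_pos_def_iff:
  fixes P Q :: "real^'n^'n"
  assumes P: "sym_pos_def P" and Q: "sym_pos_semidef Q" and "c \<noteq> 0" and "l \<ge> 1"
    and M: "M = c *\<^sub>R P" and N: "M - A = c *\<^sub>R Q"
  shows "sym_pos_def (inner_iteration_prec M A l) \<longleftrightarrow> c > 0"
proof -
  define W where "W = matrix_inv P"
  have Mi: "matrix_inv M = inverse c *\<^sub>R W"
    unfolding M W_def using sym_pos_def_invertible[OF P] \<open>c \<noteq> 0\<close> by (rule matrix_inv_scaleR)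
  then have "matrix_inv M ** (M - A) = W ** Q"
    using \<open>c \<noteq> 0\<close> by (simp add: N matrix_scaleR_left matrix_scaleR_right)
  then have "inner_iteration_prec M A l = inverse c *\<^sub>R (\<Sum>i<l. mat_power (W ** Q) i ** W)"
    by (simp add: inner_iteration_prec_def Mi matrix_scaleR_right scaleR_sum_right)
  then show ?thesis
    using sym_pos_def_scaleR_iff[OF sym_pos_def_inner_sum[OF sym_pos_def_matrix_inv[OF P] Q \<open>l \<ge> 1\<close>]]
    by (simp add: W_def)
qed

section \<open>Factored quadratic expressions, the least eigenvalue and the bound on \<mu>\<close>

lemma diag_product_expand:
  fixes D L :: "real^'n^'n"
  assumes "invertible D"
  shows "(a *\<^sub>R D + b *\<^sub>R L) ** matrix_inv D ** (a *\<^sub>R D + b *\<^sub>R transpose L)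
    = a\<^sup>2 *\<^sub>R D + (a * b) *\<^sub>R (L + transpose L) + b\<^sup>2 *\<^sub>R (L ** matrix_inv D ** transpose L)"
proof -
  \<comment> \<open>Products associate to the left, so \<open>matrix_inv D ** D\<close> is not a
    subterm here and this cancellation has to be supplied separately.\<close>
  have "L ** matrix_inv D ** D = L"
    using assms by (simp add: matrix_mul_assoc[symmetric] matrix_inv_mult)
  then show ?thesis using assms
    by (simp add: matrix_add_rdistrib matrix_add_ldistrib matrix_scaleR_left matrix_scaleR_right
        matrix_inv_mult power2_eq_square algebra_simps)
qed

text \<open>A \<open>LEAST\<close> over the reals is informative only if the minimum is attained.
  Compactness of the unit sphere gives a minimizer of the quadratic form; it is an eigenvector, and
  its value bounds every eigenvalue from below.\<close>

lemma symmetric_min_eigenvalue: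
  fixes B :: "real^'n^'n"
  assumes "symmetric_mat B"
  shows "is_eigenvalue B (lambda_min B)"
proof -
  let ?S = "sphere (0 :: real^'n) 1"
  have "axis undefined 1 \<in> ?S" by (simp add: norm_axis_1)
  then have "?S \<noteq> {}" by blast
  moreover have "continuous_on ?S (\<lambda>x. x \<bullet> (B *v x))"
    by (intro continuous_intros linear_continuous_on linear_linear[THEN iffD2] matrix_vector_mul_linear)
  ultimately obtain v where v: "v \<in> ?S" and min: "\<And>x. x \<in> ?S \<Longrightarrow> v \<bullet> (B *v v) \<le> x \<bullet> (B *v x)"
    using continuous_attains_inf[of ?S "\<lambda>x. x \<bullet> (B *v x)"] by auto
  define m where "m = v \<bullet> (B *v v)"
  define q where "q x = x \<bullet> (B *v x) - m * (x \<bullet> x)" for x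
  have v1: "v \<bullet> v = 1" using v by (simp add: dot_square_norm)
  have q0: "q x \<ge> 0" for x
  proof (cases "x = 0")
    case False
    then have "x /\<^sub>R norm x \<in> ?S" by simp
    from min[OF this] have "m \<le> (x \<bullet> (B *v x)) / (norm x)\<^sup>2"
      by (simp add: m_def matrix_vector_mult_scaleR power2_eq_square field_simps)
    then show ?thesis
      using False by (simp add: q_def dot_square_norm pos_le_divide_eq)
  qed (simp add: q_def)
  define u where "u = B *v v - m *\<^sub>R v"
  have sym: "v \<bullet> (B *v u) = u \<bullet> (B *v v)"
    using assms by (metis inner_commute inner_transpose_mult symmetric_mat_def)
  \<comment> \<open>The minimum of the nonnegative form \<open>q\<close> at \<open>v\<close> makes its first variation along \<open>u\<close> vanish.\<close>
  have expand: "q (v + t *\<^sub>R u) = 2 * t * (u \<bullet> u) + t\<^sup>2 * q u" for t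
  proof -
    have "B *v v = u + m *\<^sub>R v" by (simp add: u_def)
    then have "u \<bullet> (B *v v) = u \<bullet> u + m * (u \<bullet> v)"
      by (simp add: inner_add_right)
    moreover have "q (v + t *\<^sub>R u) = v \<bullet> (B *v v) + t * (v \<bullet> (B *v u)) + t * (u \<bullet> (B *v v))
        + t\<^sup>2 * (u \<bullet> (B *v u)) - m * (v \<bullet> v + 2 * t * (u \<bullet> v) + t\<^sup>2 * (u \<bullet> u))"
      by (simp add: q_def matrix_vector_right_distrib matrix_vector_mult_scaleR inner_add_left
          inner_add_right inner_commute[of v u] power2_eq_square algebra_simps)
    ultimately show ?thesis
      unfolding sym v1 m_def[symmetric] by (simp add: q_def algebra_simps)
  qed
  have "u = 0"
  proof (rule ccontr)
    assume "u \<noteq> 0"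
    then have uu: "u \<bullet> u > 0" by simp
    \<comment> \<open>A negative step short enough for the linear term to dominate; the
      \<open>+ 1\<close> keeps the denominator positive even if \<open>q u = 0\<close>.\<close>
    define t where "t = - (u \<bullet> u) / (q u + 1)"
    have qu: "q u + 1 > 0" using q0[of u] by simp
    have t: "t < 0" using uu qu by (simp add: t_def divide_neg_pos)
    have "t * (q u + 1) = - (u \<bullet> u)" using qu by (simp add: t_def)
    then have "2 * (u \<bullet> u) + t * q u = u \<bullet> u - t" by (simp add: algebra_simps)
    then have "2 * (u \<bullet> u) + t * q u > 0" using uu t by linarith
    then have "t * (2 * (u \<bullet> u) + t * q u) < 0" using t by (simp add: mult_neg_pos)
    then have "q (v + t *\<^sub>R u) < 0" by (simp add: expand power2_eq_square algebra_simps)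
    then show False using q0[of "v + t *\<^sub>R u"] by simp
  qed
  then have eig: "is_eigenvalue B m"
    unfolding is_eigenvalue_def using v1 by (intro exI[of _ v]) (auto simp: u_def)
  have "m \<le> c" if c: "is_eigenvalue B c" for c
  proof -
    obtain x where x: "x \<noteq> 0" "B *v x = c *\<^sub>R x" using c unfolding is_eigenvalue_def by blast
    have "m * (x \<bullet> x) \<le> c * (x \<bullet> x)" using q0[of x] by (simp add: q_def x(2))
    then show ?thesis by (rule mult_right_le_imp_le) (simp add: x(1))
  qed
  then have "lambda_min B = m" unfolding lambda_min_def using eig by (intro Least_equality)
  then show ?thesis using eig by simp
qed

lemma ssor_mu_gt_half:
  fixes L D :: "real^('n::{finite,linorder})^('n::{finite,linorder})"
  assumes L: "strictly_lower_triangular L" and diag: "diagonal_mat D" and D: "sym_pos_def D"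
  shows "ssor_mu L D > 1 / 2"
proof -
  define S where "S = diag_inv_sqrt D"
  define W where "W = matrix_inv D"
  \<comment> \<open>Completing the square: the coefficients 1/2 and 1 make the \<open>L\<close>
    terms of \<open>2 *\<^sub>R F\<close> agree with \<open>B\<close>, and the leftover multiple of
    \<open>S ** D ** S\<close> is 2 * (1/2)^2 = 1/2.\<close>
  define E where "E = (1 / 2) *\<^sub>R D + 1 *\<^sub>R L"
  define F where "F = S ** (E ** W ** transpose E) ** transpose S"
  define B where "B = 2 *\<^sub>R (S ** L ** W ** transpose L ** S) + S ** (L + transpose L) ** S"
  have D_sym: "transpose D = D" using D by (simp add: sym_pos_def_def symmetric_mat_def)
  have S: "sym_pos_def S" unfolding S_def using D by (rule sym_pos_def_diag_inv_sqrt)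
  then have S_sym: "transpose S = S" by (simp add: sym_pos_def_def symmetric_mat_def)
  \<comment> \<open>This makes \<open>S ** D\<close> a right inverse of \<open>S\<close>, hence also
    a left inverse, which is the symmetric form \<open>S ** D ** S = mat 1\<close>.\<close>
  have "S ** (S ** D) = mat 1"
    using diag_inv_sqrt_square[OF diag D] matrix_inv_mult(2)[OF sym_pos_def_invertible[OF D]]
    by (simp add: S_def matrix_mul_assoc)
  then have SDS: "S ** D ** S = mat 1" by (simp only: matrix_left_right_inverse)
  have "invertible E"
    unfolding E_def using diag sym_pos_def_diag_pos[OF D, THEN less_imp_neq, symmetric] L
    by (rule invertible_diagonal_plus_strictly_lower) simp
  then have F: "sym_pos_def F"
    unfolding F_def W_def
    by (intro sym_pos_def_congruence sym_pos_def_matrix_inv D sym_pos_def_invertible[OF S])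
  have "E ** W ** transpose E = (1 / 4) *\<^sub>R D + (1 / 2) *\<^sub>R (L + transpose L) + L ** W ** transpose L"
    using diag_product_expand[OF sym_pos_def_invertible[OF D], of "1/2" 1 L]
    by (simp add: E_def W_def transpose_plus transpose_scalar D_sym power2_eq_square)
  then have "2 *\<^sub>R F = (1 / 2) *\<^sub>R (S ** D ** S) + B"
    by (simp add: F_def B_def S_sym matrix_add_ldistrib matrix_add_rdistrib matrix_scaleR_left
        matrix_scaleR_right matrix_mul_assoc algebra_simps)
  then have B_eq: "B = 2 *\<^sub>R F - (1 / 2) *\<^sub>R mat 1" by (simp add: SDS)
  have "symmetric_mat B"
    using F by (simp add: B_eq sym_pos_def_def symmetric_mat_def vec_eq_iff transpose_def mat_def)
  then obtain v where v: "v \<noteq> 0" "B *v v = lambda_min B *\<^sub>R v"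
    using symmetric_min_eigenvalue unfolding is_eigenvalue_def by blast
  have "(lambda_min B + 1 / 2) * (v \<bullet> v) = v \<bullet> (B *v v) + 1 / 2 * (v \<bullet> v)"
    by (simp add: v(2) algebra_simps)
  also have "\<dots> = 2 * (v \<bullet> (F *v v))"
    by (simp add: B_eq matrix_vector_mult_diff_rdistrib scaleR_matrix_vector_assoc[symmetric]
        inner_diff_right)
  also have "\<dots> > 0" using F v(1) by (simp add: sym_pos_def_def)
  finally have "lambda_min B + 1 / 2 > 0" by (rule zero_less_mult_pos2) (simp add: v(1))
  moreover have "ssor_mu L D = lambda_min B + 1"
    by (simp add: ssor_mu_def Let_def B_def S_def W_def)
  ultimately show ?thesis by simp
qed

section \<open>The SSOR splitting and the conclusion\<close>

lemma ssor_M_splitting: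
  fixes A L D :: "real^('n::{finite,linorder})^('n::{finite,linorder})"
  assumes A: "A = L + D + transpose L" and L: "strictly_lower_triangular L"
    and diag: "diagonal_mat D" and D: "sym_pos_def D" and "ssor_defined \<omega>"
  obtains P Q where "sym_pos_def P" "sym_pos_semidef Q"
    "ssor_M L D \<omega> = inverse (\<omega> * (2 - \<omega>)) *\<^sub>R P"
    "ssor_M L D \<omega> - A = inverse (\<omega> * (2 - \<omega>)) *\<^sub>R Q"
proof
  define W where "W = matrix_inv D"
  define E where "E a b = a *\<^sub>R D + b *\<^sub>R L" for a b
  define c where "c = \<omega> * (2 - \<omega>)"
  have c: "c \<noteq> 0" using \<open>ssor_defined \<omega>\<close> by (simp add: ssor_defined_def c_def)
  have D_sym: "transpose D = D" using D by (simp add: sym_pos_def_def symmetric_mat_def)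
  have W: "sym_pos_def W" unfolding W_def using D by (rule sym_pos_def_matrix_inv)
  have E_tr: "transpose (E a b) = a *\<^sub>R D + b *\<^sub>R transpose L" for a b
    by (simp add: E_def transpose_plus transpose_scalar D_sym)
  have expand: "E a b ** W ** transpose (E a b)
      = a\<^sup>2 *\<^sub>R D + (a * b) *\<^sub>R (L + transpose L) + b\<^sup>2 *\<^sub>R (L ** W ** transpose L)" for a b
    unfolding E_tr unfolding E_def W_def by (rule diag_product_expand[OF sym_pos_def_invertible[OF D]])
  define P where "P = E 1 \<omega> ** W ** transpose (E 1 \<omega>)"
  define Q where "Q = E (1 - \<omega>) (- \<omega>) ** W ** transpose (E (1 - \<omega>) (- \<omega>))"
  have "invertible (E 1 \<omega>)"
    unfolding E_def using diag sym_pos_def_diag_pos[OF D, THEN less_imp_neq, symmetric] L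
    by (rule invertible_diagonal_plus_strictly_lower) simp
  then show "sym_pos_def P" unfolding P_def by (rule sym_pos_def_congruence[OF W])
  \<comment> \<open>Definiteness can fail: at \<omega> = 1 the outer factor of \<open>Q\<close> is
    the nilpotent matrix \<open>- L\<close>.\<close>
  show "sym_pos_semidef Q"
    unfolding Q_def by (rule sym_pos_semidef_congruence[OF sym_pos_def_imp_semidef[OF W]])
  show M: "ssor_M L D \<omega> = inverse (\<omega> * (2 - \<omega>)) *\<^sub>R P"
    by (simp add: ssor_M_def P_def W_def E_tr) (simp add: E_def)
  \<comment> \<open>The coefficients of \<open>D\<close> and of \<open>L + transpose L\<close> both
    become \<omega> (2 - \<omega>), as 1 - (1 - \<omega>)^2 and as \<omega> + \<omega> (1 -
    \<omega>); the \<omega>^2 terms cancel.\<close>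
  have "P - Q = c *\<^sub>R A"
    unfolding P_def Q_def expand A c_def
    by (simp add: vec_eq_iff power2_eq_square algebra_simps)
  then have "inverse c *\<^sub>R (P - Q) = A" using c by simp
  then have "inverse c *\<^sub>R P - A = inverse c *\<^sub>R Q" by (auto simp: scaleR_right_diff_distrib)
  then show "ssor_M L D \<omega> - A = inverse (\<omega> * (2 - \<omega>)) *\<^sub>R Q"
    by (simp only: M c_def)
qed

theorem theorem2p11:
  fixes A L D :: "real^('n::{finite,linorder})^('n::{finite,linorder})" and \<omega> \<mu> :: real
  assumes "A = L + D + transpose L"
    and "symmetric_mat A"
    and "strictly_lower_triangular L"
    and "diagonal_mat D"
    and "sym_pos_def D"
    and "\<mu> = ssor_mu L D"
  shows "(ssor_defined \<omega> \<and> invertible (ssor_M L D \<omega>) \<longleftrightarrow> \<omega> \<noteq> 0 \<and> \<omega> \<noteq> 2)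
    \<and> (\<forall>l\<ge>1. odd l \<longrightarrow>
         (ssor_defined \<omega> \<and> sym_pos_def (inner_iteration_prec (ssor_M L D \<omega>) A l)
            \<longleftrightarrow> \<omega> \<in> {0<..<2}))
    \<and> (\<forall>l\<ge>1. even l \<longrightarrow>
         (\<mu> < 0 \<and> (\<omega> < (1 + sqrt (1 - 2 * \<mu>)) / \<mu>
                      \<or> 0 < \<omega> \<and> \<omega> < (1 - sqrt (1 - 2 * \<mu>)) / \<mu>
                      \<or> 2 < \<omega>)
          \<or> 0 < \<mu> \<and> \<mu> < 1 / 2 \<and> (0 < \<omega> \<and> \<omega> < (1 - sqrt (1 - 2 * \<mu>)) / \<mu>
                      \<or> 2 < \<omega> \<and> \<omega> < (1 + sqrt (1 - 2 * \<mu>)) / \<mu>)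
          \<or> 1 / 2 < \<mu> \<and> 0 < \<omega> \<and> \<omega> < 2)
         \<longrightarrow> ssor_defined \<omega> \<and> sym_pos_def (inner_iteration_prec (ssor_M L D \<omega>) A l))"
proof -
  note L = \<open>strictly_lower_triangular L\<close> and diag = \<open>diagonal_mat D\<close> and D = \<open>sym_pos_def D\<close>
  have mu: "\<mu> > 1 / 2" using ssor_mu_gt_half[OF L diag D] \<open>\<mu> = ssor_mu L D\<close> by simp
  have defined: "ssor_defined \<omega> \<longleftrightarrow> \<omega> \<noteq> 0 \<and> \<omega> \<noteq> 2" by (auto simp: ssor_defined_def)
  have inv: "invertible (ssor_M L D \<omega>)" if dfn: "ssor_defined \<omega>"
  proof -
    obtain P where "sym_pos_def P" "ssor_M L D \<omega> = inverse (\<omega> * (2 - \<omega>)) *\<^sub>R P"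
      by (rule ssor_M_splitting[OF \<open>A = _\<close> L diag D dfn])
    moreover have "inverse (\<omega> * (2 - \<omega>)) \<noteq> 0" using dfn by (simp add: ssor_defined_def)
    ultimately show ?thesis by (metis scalar_invertible_iff sym_pos_def_invertible)
  qed
  have range: "\<omega> * (2 - \<omega>) > 0 \<longleftrightarrow> \<omega> \<in> {0<..<2}" by (auto simp: zero_less_mult_iff)
  have main: "ssor_defined \<omega> \<and> sym_pos_def (inner_iteration_prec (ssor_M L D \<omega>) A l)
      \<longleftrightarrow> \<omega> \<in> {0<..<2}" if "l \<ge> 1" for l
  proof (cases "ssor_defined \<omega>")
    case True
    obtain P Q where "sym_pos_def P" "sym_pos_semidef Q"
      "ssor_M L D \<omega> = inverse (\<omega> * (2 - \<omega>)) *\<^sub>R P"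
      "ssor_M L D \<omega> - A = inverse (\<omega> * (2 - \<omega>)) *\<^sub>R Q"
      by (rule ssor_M_splitting[OF \<open>A = _\<close> L diag D True])
    moreover have "inverse (\<omega> * (2 - \<omega>)) \<noteq> 0" using True by (simp add: ssor_defined_def)
    ultimately have "sym_pos_def (inner_iteration_prec (ssor_M L D \<omega>) A l)
        \<longleftrightarrow> inverse (\<omega> * (2 - \<omega>)) > 0"
      using \<open>l \<ge> 1\<close> by (intro inner_iteration_prec_pos_def_iff)
    then show ?thesis using True range by (simp only: inverse_positive_iff_positive simp_thms)
  qed (use defined in auto)
  \<comment> \<open>The premise weakens the case distinction for even \<open>l\<close>: the
    square-root bounds are dropped, since the cases they belong to contradict
    \<open>mu\<close>.\<close>
  have "\<omega> \<in> {0<..<2}" if "\<mu> < 0 \<or> \<mu> < 1 / 2 \<or> 0 < \<omega> \<and> \<omega> < 2"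
    using that mu by auto
  then show ?thesis using main inv defined by blast
qed

end
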